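(* Assume that $v_0$ and $v_{2n+1}$ are independent and also independent of $v_1,\dots,v_{2n}$. Then, for any pair of positive integers $(n,m_n)$ such that $m_n<n$, $$\mathbf{E}\left[\frac{2n+1}{2m_n+1}\sum_{l=0}^{2m_n}\left(\sum_{k=1}^{2n+1} q^{2n+1}_{k-1,l}\,\Delta v_k\right)^2\right]\ \ge\ \mathbf{E}\left[(v_0)^2+(v_{2n+1})^2\right].$$
   Context: The real random variables $v_0,v_1,\dots,v_{2n+1}$ model the additive micro-structure noise in the observations $Y_{t_k}=X_{t_k}+v_k$ of a one-dimensional Itô process $X$ at the times $t_k=k/(2n+1)$, $k=0,1,\dots,2n+1$. $\mathbf{E}$ denotes expectation, and $\Delta v_k=v_k-v_{k-1}$ for $k=1,\dots,2n+1$. For $0\le k,l\le 2n$, $$q^{2n+1}_{k,l} = \begin{cases} (2n+1)^{-1/2} & l=0,\\ (2n+1)^{-1/2}\sqrt2\,\cos\left(\dfrac{lk\pi}{2n+1}\right) & l=2,4,\dots,2n,\\ (2n+1)^{-1/2}\sqrt2\,\sin\left(\dfrac{(l+1)k\pi}{2n+1}\right) & l=1,3,\dots,2n-1.\end{cases}$$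
   Formalization: The formal statement additionally assumes that v_0 and v_{2n+1} are integrable with mean zero; without this the claim fails, e.g. for v_k = 1 for all k, where the left side is 0 and the right side is 2. *)

theory Defs
  imports "HOL-Probability.Probability"
begin

text \<open>The coefficients $q^{N}_{k,l}$, used for $N = 2n+1$ and $0 \le k, l \le 2n$.\<close>

definition q_coeff :: "nat \<Rightarrow> nat \<Rightarrow> nat \<Rightarrow> real" where
  "q_coeff N k l =
     (if l = 0 then real N powr (-1/2)
      else if even l then real N powr (-1/2) * (sqrt 2 * cos (real l * real k * pi / real N))
      else real N powr (-1/2) * (sqrt 2 * sin (real (l + 1) * real k * pi / real N)))"

end

theory Submission
  imports Defs
begin

text \<open>
  Write \<open>N = 2n+1\<close>. Summation by parts moves the differences from the noise to the coefficients:
  the inner sum equals \<open>q\<^sub>N\<^sub>-\<^sub>1\<^sub>,\<^sub>l v\<^sub>N - q\<^sub>0\<^sub>,\<^sub>l v\<^sub>0 + W\<^sub>l\<close>, where \<open>W\<^sub>l\<close> is a linear combination of the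
  interior variables \<open>v\<^sub>1, \<dots>, v\<^sub>2\<^sub>n\<close> only. The three summands are independent and the two boundary ones
  are centred, so the second moment splits into three parts
  (\<open>nn_integral_square_add_indep\<close>). Dropping the contribution of \<open>W\<^sub>l\<close> and summing over \<open>l\<close>
  leaves the second moments of \<open>v\<^sub>0\<close> and \<open>v\<^sub>N\<close> with the weights
  \<open>\<Sum>\<^sub>l q\<^sub>k\<^sub>,\<^sub>l\<^sup>2\<close> at \<open>k = 0\<close> and \<open>k = N - 1\<close>. Each sine column pairs with a cosine column of the
  same frequency, so both weights equal \<open>(2m+1)/N\<close> (\<open>sum_q_coeff_squared\<close>), which cancels
  the normalising factor.

  The second moments may be infinite and the interior variables may fail to be integrable, so that
  covariances need not exist. Expectations of squares are therefore taken in the extended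
  nonnegative reals, and the splitting is obtained by integrating out one centred variable with
  the other one frozen (Tonelli) instead of by showing that a covariance vanishes.
\<close>

text \<open>If the second moment of \<open>X\<close> is infinite, both sides are infinite, since
  \<open>X\<^sup>2 \<le> 2(X + w)\<^sup>2 + 2w\<^sup>2\<close>. Otherwise the square can be expanded.\<close>

lemma (in prob_space) nn_integral_square_add_const:
  fixes X :: "'a \<Rightarrow> real" and w :: real
  assumes X: "integrable M X" and mean: "expectation X = 0"
  shows "(\<integral>\<^sup>+\<omega>. ennreal ((X \<omega> + w)\<^sup>2) \<partial>M) = (\<integral>\<^sup>+\<omega>. ennreal ((X \<omega>)\<^sup>2) \<partial>M) + ennreal (w\<^sup>2)"
proof (cases "integrable M (\<lambda>\<omega>. (X \<omega>)\<^sup>2)")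
  case True
  have expand: "(X \<omega> + w)\<^sup>2 = (X \<omega>)\<^sup>2 + (2 * w * X \<omega> + w\<^sup>2)" for \<omega>
    by (simp add: power2_eq_square algebra_simps)
  have int: "integrable M (\<lambda>\<omega>. (X \<omega> + w)\<^sup>2)"
    unfolding expand using True X by auto
  have "expectation (\<lambda>\<omega>. (X \<omega> + w)\<^sup>2) = expectation (\<lambda>\<omega>. (X \<omega>)\<^sup>2) + w\<^sup>2"
    unfolding expand using True X mean by (simp add: prob_space)
  then show ?thesis
    using nn_integral_eq_integral[OF int] nn_integral_eq_integral[OF True]
    by (simp flip: ennreal_plus)
next
  case False
  have [measurable]: "X \<in> borel_measurable M"
    using X by auto
  have inf: "(\<integral>\<^sup>+\<omega>. ennreal ((X \<omega>)\<^sup>2) \<partial>M) = \<infinity>"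
    using False by (auto simp: integrable_iff_bounded not_less top_unique)
  have dom: "(X \<omega>)\<^sup>2 \<le> 2 * (X \<omega> + w)\<^sup>2 + 2 * w\<^sup>2" for \<omega>
    using zero_le_power2[of "X \<omega> + 2 * w"] by (simp add: power2_eq_square algebra_simps)
  have "(\<integral>\<^sup>+\<omega>. ennreal ((X \<omega>)\<^sup>2) \<partial>M) \<le> (\<integral>\<^sup>+\<omega>. ennreal 2 * ennreal ((X \<omega> + w)\<^sup>2) + ennreal (2 * w\<^sup>2) \<partial>M)"
    by (intro nn_integral_mono) (use ennreal_leI[OF dom] in \<open>simp add: ennreal_mult\<close>)
  also have "\<dots> = ennreal 2 * (\<integral>\<^sup>+\<omega>. ennreal ((X \<omega> + w)\<^sup>2) \<partial>M) + ennreal (2 * w\<^sup>2)"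
    by (simp add: nn_integral_add nn_integral_cmult emeasure_space_1)
  finally have "(\<integral>\<^sup>+\<omega>. ennreal ((X \<omega> + w)\<^sup>2) \<partial>M) = \<infinity>"
    using inf by (auto simp: top_unique ennreal_mult_eq_top_iff)
  with inf show ?thesis
    by simp
qed

text \<open>The joint law is a product measure, so \<open>X\<close> can be integrated out first; for each frozen
  value of \<open>Y\<close> this is the previous lemma. Only the mean of \<open>X\<close> enters, which makes the
  equality applicable with a \<open>Y\<close> that has no mean.\<close>

lemma (in prob_space) nn_integral_square_add_indep:
  fixes X Y :: "'a \<Rightarrow> real"
  assumes X: "integrable M X" and mean: "expectation X = 0"
    and indep: "indep_var borel X borel Y"
  shows "(\<integral>\<^sup>+\<omega>. ennreal ((X \<omega> + Y \<omega>)\<^sup>2) \<partial>M)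
    = (\<integral>\<^sup>+\<omega>. ennreal ((X \<omega>)\<^sup>2) \<partial>M) + (\<integral>\<^sup>+\<omega>. ennreal ((Y \<omega>)\<^sup>2) \<partial>M)"
proof -
  have [measurable]: "X \<in> borel_measurable M" "Y \<in> borel_measurable M"
    and joint: "distr M borel X \<Otimes>\<^sub>M distr M borel Y = distr M (borel \<Otimes>\<^sub>M borel) (\<lambda>\<omega>. (X \<omega>, Y \<omega>))"
    using indep unfolding indep_var_distribution_eq by auto
  interpret DX: prob_space "distr M borel X" by (rule prob_space_distr) simp
  interpret DY: prob_space "distr M borel Y" by (rule prob_space_distr) simp
  interpret P: pair_sigma_finite "distr M borel X" "distr M borel Y" ..
  have "(\<integral>\<^sup>+\<omega>. ennreal ((X \<omega> + Y \<omega>)\<^sup>2) \<partial>M)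
      = (\<integral>\<^sup>+z. ennreal ((fst z + snd z)\<^sup>2) \<partial>(distr M borel X \<Otimes>\<^sub>M distr M borel Y))"
    unfolding joint by (subst nn_integral_distr) simp_all
  also have "\<dots> = (\<integral>\<^sup>+y. \<integral>\<^sup>+x. ennreal ((x + y)\<^sup>2) \<partial>distr M borel X \<partial>distr M borel Y)"
    by (subst P.nn_integral_snd[symmetric]) simp_all
  also have "\<dots> = (\<integral>\<^sup>+y. (\<integral>\<^sup>+\<omega>. ennreal ((X \<omega>)\<^sup>2) \<partial>M) + ennreal (y\<^sup>2) \<partial>distr M borel Y)"
    by (intro nn_integral_cong) (simp add: nn_integral_distr nn_integral_square_add_const[OF X mean])
  also have "\<dots> = (\<integral>\<^sup>+\<omega>. ennreal ((X \<omega>)\<^sup>2) \<partial>M) + (\<integral>\<^sup>+\<omega>. ennreal ((Y \<omega>)\<^sup>2) \<partial>M)"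
    using DY.emeasure_space_1 by (simp add: nn_integral_add nn_integral_distr)
  finally show ?thesis .
qed

text \<open>The columns \<open>2j - 1\<close> and \<open>2j\<close> are the sine and the cosine of the same angle
  \<open>2jk\<pi>/N\<close>, scaled by \<open>\<surd>(2/N)\<close>, so each such pair contributes \<open>2/N\<close>, whatever \<open>k\<close> is;
  the constant column \<open>l = 0\<close> contributes \<open>1/N\<close>.\<close>

lemma sum_q_coeff_squared:
  assumes "N > 0"
  shows "(\<Sum>l=0..2*m. (q_coeff N k l)\<^sup>2) = real (2 * m + 1) / real N"
proof -
  have scale: "(real N powr (-1/2))\<^sup>2 = 1 / real N"
    using assms by (simp add: powr_power powr_neg_one)
  show ?thesis
  proof (induction m)
    case 0
    show ?case using scale by (simp add: q_coeff_def)
  next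
    case (Suc m)
    define x where "x = real (2 * m + 2) * real k * pi / real N"
    have "q_coeff N k (Suc (2 * m)) = real N powr (-1/2) * (sqrt 2 * sin x)"
      and "q_coeff N k (Suc (Suc (2 * m))) = real N powr (-1/2) * (sqrt 2 * cos x)"
      by (simp_all add: q_coeff_def x_def)
    then have "(q_coeff N k (Suc (2 * m)))\<^sup>2 + (q_coeff N k (Suc (Suc (2 * m))))\<^sup>2
      = 1 / real N * (2 * ((sin x)\<^sup>2 + (cos x)\<^sup>2))"
      by (simp only: power_mult_distrib scale distrib_left real_sqrt_pow2 zero_le_numeral)
    then have pair: "(q_coeff N k (Suc (2 * m)))\<^sup>2 + (q_coeff N k (Suc (Suc (2 * m))))\<^sup>2
      = 2 / real N"
      by simp
    have "(\<Sum>l=0..2 * Suc m. (q_coeff N k l)\<^sup>2) = real (2 * m + 1) / real N + 2 / real N"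
      using Suc pair by simp
    also have "\<dots> = real (2 * Suc m + 1) / real N"
      by (simp flip: add_divide_distrib)
    finally show ?case .
  qed
qed

lemma summation_by_parts:
  fixes f v :: "nat \<Rightarrow> real"
  shows "(\<Sum>k=1..Suc N. f (k - 1) * (v k - v (k - 1)))
    = f N * v (Suc N) - f 0 * v 0 + (\<Sum>k=1..N. (f (k - 1) - f k) * v k)"
  by (induction N) (simp_all add: algebra_simps)

text \<open>The independence of the boundary pair from the interior splits off the second moment of the
  interior part, which is dropped; the independence of the two boundary variables from each other
  then separates their contributions.\<close>

lemma (in prob_space) second_moment_weighted_increments_ge:
  fixes v :: "nat \<Rightarrow> 'a \<Rightarrow> real" and f :: "nat \<Rightarrow> real" and N :: nat
  assumes v0: "integrable M (v 0)" "expectation (v 0) = 0"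
    and vN: "integrable M (v (Suc N))" "expectation (v (Suc N)) = 0"
    and ends: "indep_var borel (v 0) borel (v (Suc N))"
    and inner: "indep_var
           (\<Pi>\<^sub>M k\<in>{0, Suc N}. borel) (\<lambda>\<omega>. \<lambda>k\<in>{0, Suc N}. v k \<omega>)
           (\<Pi>\<^sub>M k\<in>{1..N}. borel) (\<lambda>\<omega>. \<lambda>k\<in>{1..N}. v k \<omega>)"
  shows "ennreal ((f 0)\<^sup>2) * (\<integral>\<^sup>+\<omega>. ennreal ((v 0 \<omega>)\<^sup>2) \<partial>M)
       + ennreal ((f N)\<^sup>2) * (\<integral>\<^sup>+\<omega>. ennreal ((v (Suc N) \<omega>)\<^sup>2) \<partial>M)
     \<le> (\<integral>\<^sup>+\<omega>. ennreal ((\<Sum>k=1..Suc N. f (k - 1) * (v k \<omega> - v (k - 1) \<omega>))\<^sup>2) \<partial>M)"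
proof -
  define A where "A \<omega> = - f 0 * v 0 \<omega>" for \<omega>
  define B where "B \<omega> = f N * v (Suc N) \<omega>" for \<omega>
  define W where "W \<omega> = (\<Sum>k=1..N. (f (k - 1) - f k) * v k \<omega>)" for \<omega>
  have [measurable]: "v 0 \<in> borel_measurable M" "v (Suc N) \<in> borel_measurable M"
    using v0 vN by auto
  have A: "integrable M A" "expectation A = 0" and B: "integrable M B" "expectation B = 0"
    using v0 vN by (auto simp: A_def[abs_def] B_def[abs_def])
  have AB: "indep_var borel A borel B"
  proof -
    have "indep_var borel ((\<lambda>x. - f 0 * x) \<circ> v 0) borel ((\<lambda>x. f N * x) \<circ> v (Suc N))"
      by (rule indep_var_compose[OF ends]) measurable
    then show ?thesis by (simp add: A_def[abs_def] B_def[abs_def] comp_def)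
  qed
  have ABW: "indep_var borel (\<lambda>\<omega>. A \<omega> + B \<omega>) borel W"
  proof -
    define g where "g x = - f 0 * x 0 + f N * x (Suc N)" for x :: "nat \<Rightarrow> real"
    define h where "h x = (\<Sum>k=1..N. (f (k - 1) - f k) * x k)" for x :: "nat \<Rightarrow> real"
    have g: "g \<in> borel_measurable (\<Pi>\<^sub>M k\<in>{0, Suc N}. borel)"
      unfolding g_def by measurable
    have h: "h \<in> borel_measurable (\<Pi>\<^sub>M k\<in>{1..N}. borel)"
      unfolding h_def by (intro borel_measurable_sum borel_measurable_times) auto
    have "indep_var borel (g \<circ> (\<lambda>\<omega>. \<lambda>k\<in>{0, Suc N}. v k \<omega>))
                    borel (h \<circ> (\<lambda>\<omega>. \<lambda>k\<in>{1..N}. v k \<omega>))"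
      by (rule indep_var_compose[OF inner g h])
    moreover have "g \<circ> (\<lambda>\<omega>. \<lambda>k\<in>{0, Suc N}. v k \<omega>) = (\<lambda>\<omega>. A \<omega> + B \<omega>)"
      by (auto simp: g_def A_def B_def)
    moreover have "h \<circ> (\<lambda>\<omega>. \<lambda>k\<in>{1..N}. v k \<omega>) = W"
      by (auto simp: h_def W_def intro!: sum.cong)
    ultimately show ?thesis by simp
  qed
  have "ennreal ((f 0)\<^sup>2) * (\<integral>\<^sup>+\<omega>. ennreal ((v 0 \<omega>)\<^sup>2) \<partial>M)
       + ennreal ((f N)\<^sup>2) * (\<integral>\<^sup>+\<omega>. ennreal ((v (Suc N) \<omega>)\<^sup>2) \<partial>M)
     = (\<integral>\<^sup>+\<omega>. ennreal ((A \<omega>)\<^sup>2) \<partial>M) + (\<integral>\<^sup>+\<omega>. ennreal ((B \<omega>)\<^sup>2) \<partial>M)"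
    by (simp add: A_def B_def power_mult_distrib ennreal_mult nn_integral_cmult)
  also have "\<dots> = (\<integral>\<^sup>+\<omega>. ennreal ((A \<omega> + B \<omega>)\<^sup>2) \<partial>M)"
    by (rule nn_integral_square_add_indep[OF A AB, symmetric])
  also have "\<dots> \<le> (\<integral>\<^sup>+\<omega>. ennreal ((A \<omega> + B \<omega>)\<^sup>2) \<partial>M) + (\<integral>\<^sup>+\<omega>. ennreal ((W \<omega>)\<^sup>2) \<partial>M)"
    by simp
  also have "\<dots> = (\<integral>\<^sup>+\<omega>. ennreal ((A \<omega> + B \<omega> + W \<omega>)\<^sup>2) \<partial>M)"
    using A B by (intro nn_integral_square_add_indep[OF _ _ ABW, symmetric]) simp_all
  also have "\<dots> = (\<integral>\<^sup>+\<omega>. ennreal ((\<Sum>k=1..Suc N. f (k - 1) * (v k \<omega> - v (k - 1) \<omega>))\<^sup>2) \<partial>M)"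
    by (intro nn_integral_cong, subst summation_by_parts[of f "\<lambda>k. v k \<omega>" N for \<omega>])
      (simp add: A_def B_def W_def)
  finally show ?thesis .
qed

theorem proposition3p2:
  fixes M :: "'a measure" and v :: "nat \<Rightarrow> 'a \<Rightarrow> real" and n m :: nat
  assumes "prob_space M"
    and "\<And>k. k \<le> 2 * n + 1 \<Longrightarrow> v k \<in> borel_measurable M"
    and "integrable M (v 0)" and "prob_space.expectation M (v 0) = 0"
    and "integrable M (v (2 * n + 1))" and "prob_space.expectation M (v (2 * n + 1)) = 0"
    and "prob_space.indep_var M borel (v 0) borel (v (2 * n + 1))"
    and "prob_space.indep_var M
           (\<Pi>\<^sub>M k\<in>{0, 2 * n + 1}. borel) (\<lambda>\<omega>. \<lambda>k\<in>{0, 2 * n + 1}. v k \<omega>)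
           (\<Pi>\<^sub>M k\<in>{1..2 * n}. borel) (\<lambda>\<omega>. \<lambda>k\<in>{1..2 * n}. v k \<omega>)"
    and "0 < m" and "m < n"
  shows "(\<integral>\<^sup>+ \<omega>. ennreal (real (2 * n + 1) / real (2 * m + 1) *
            (\<Sum>l=0..2 * m. (\<Sum>k=1..2 * n + 1.
               q_coeff (2 * n + 1) (k - 1) l * (v k \<omega> - v (k - 1) \<omega>))\<^sup>2)) \<partial>M)
         \<ge> (\<integral>\<^sup>+ \<omega>. ennreal ((v 0 \<omega>)\<^sup>2 + (v (2 * n + 1) \<omega>)\<^sup>2) \<partial>M)"
proof -
  interpret prob_space M by fact
  define N where "N = 2 * n + 1"
  define c where "c = real N / real (2 * m + 1)"
  define S where "S l \<omega> = (\<Sum>k=1..N. q_coeff N (k - 1) l * (v k \<omega> - v (k - 1) \<omega>))" for l \<omega>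
  define I where "I k = (\<integral>\<^sup>+\<omega>. ennreal ((v k \<omega>)\<^sup>2) \<partial>M)" for k
  have N: "N = Suc (2 * n)" "0 < N" and c: "0 \<le> c"
    by (simp_all add: N_def c_def)
  have meas[measurable]: "v k \<in> borel_measurable M" if "k \<le> N" for k
    using assms(2) that by (simp add: N_def)
  have S_meas[measurable]: "S l \<in> borel_measurable M" for l
    unfolding S_def[abs_def]
    by (intro borel_measurable_sum borel_measurable_times borel_measurable_diff meas) auto
  have column: "ennreal ((q_coeff N 0 l)\<^sup>2) * I 0 + ennreal ((q_coeff N (2 * n) l)\<^sup>2) * I N
      \<le> (\<integral>\<^sup>+\<omega>. ennreal ((S l \<omega>)\<^sup>2) \<partial>M)" for l
    using second_moment_weighted_increments_ge[of v "2 * n" "\<lambda>k. q_coeff N k l"] assms(3-8)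
    by (simp add: I_def S_def N(1))
  have weight: "ennreal c * (\<Sum>l=0..2*m. ennreal ((q_coeff N k l)\<^sup>2)) = 1" for k
    using N(2) c by (simp add: sum_q_coeff_squared c_def flip: ennreal_mult)
  have "(\<integral>\<^sup>+ \<omega>. ennreal ((v 0 \<omega>)\<^sup>2 + (v N \<omega>)\<^sup>2) \<partial>M) = I 0 + I N"
    by (simp add: I_def nn_integral_add)
  also have "\<dots> = ennreal c * (\<Sum>l=0..2*m. ennreal ((q_coeff N 0 l)\<^sup>2)) * I 0
      + ennreal c * (\<Sum>l=0..2*m. ennreal ((q_coeff N (2 * n) l)\<^sup>2)) * I N"
    by (simp only: weight mult_1)
  also have "\<dots> = ennreal c *
      (\<Sum>l=0..2*m. ennreal ((q_coeff N 0 l)\<^sup>2) * I 0 + ennreal ((q_coeff N (2 * n) l)\<^sup>2) * I N)"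
    by (simp only: sum.distrib sum_distrib_right distrib_left mult.assoc)
  also have "\<dots> \<le> ennreal c * (\<Sum>l=0..2*m. \<integral>\<^sup>+\<omega>. ennreal ((S l \<omega>)\<^sup>2) \<partial>M)"
    by (intro mult_left_mono sum_mono column) simp
  also have "\<dots> = (\<integral>\<^sup>+\<omega>. ennreal (c * (\<Sum>l=0..2*m. (S l \<omega>)\<^sup>2)) \<partial>M)"
    using c by (simp add: ennreal_mult sum_nonneg nn_integral_cmult nn_integral_sum flip: sum_ennreal)
  finally show ?thesis
    by (simp only: N_def c_def S_def)
qed

end
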